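(* Let $k\in\{1,2,3,4,5,6,7\}$ and let $n$ be a non-negative integer whose binary class is $k$-dimensional. Then $f(n)=S(\overline{n})+\Delta_k$, where $\Delta_k=0,0,0,1,2,4,7$ for $k=1,2,3,4,5,6,7$, respectively.
   Context: Consider the directed graph whose vertices are the non-negative integers, with an edge $n\to n-2^s$ ($s\ge 0$) whenever the $2^s$-bit in the binary expansion of $n$ is $0$ and $n-2^s\ge 0$. $f(n)$ denotes the length (number of edges) of the longest directed path starting at $n$. The binary class of $n$ is the set of all non-negative integers $m$ whose binary representation agrees with that of $n$ after all trailing $1$'s have been removed from both; $\overline{n}$ denotes its minimal element, i.e. $n$ with all trailing $1$'s deleted ($\overline{n}=0$ if $n=2^t-1$). Bracket form: for integers $\alpha_j\ge 0$, $[\alpha_k,\dots,\alpha_1]$ denotes the number whose binary string is $1^{\alpha_k}0\,1^{\alpha_{k-1}}0\cdots 1^{\alpha_1}0$ ($1^{\alpha}$ means $\alpha$ consecutive digits $1$). The class of $n$ is $k$-dimensional if $\overline{n}=[\alpha_k,\dots,\alpha_1]$ with $\alpha_k\ge 1$. Then $S(\overline{n})=\sum_{j=1}^k j\alpha_j$. *)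

theory Defs
  imports Main "Graph_Theory.Arc_Walk"
begin

section \<open>The graph and the longest path length\<close>

text \<open>For fixed \<open>n\<close>, different \<open>s\<close> give different targets \<open>n - 2 ^ s\<close>, so an arc is
  faithfully represented by the pair of its end points.\<close>

definition bit_graph :: "(nat, nat \<times> nat) pre_digraph" where
  "bit_graph =
     \<lparr> verts = UNIV,
       arcs = {(n, n - 2 ^ s) | n s. \<not> bit n s \<and> 2 ^ s \<le> n},
       tail = fst,
       head = snd \<rparr>"

definition path_lengths :: "nat \<Rightarrow> nat set" where
  "path_lengths n = {length p | p v. pre_digraph.apath bit_graph n p v}"

definition longest_path :: "nat \<Rightarrow> nat" where
  "longest_path n = Max (path_lengths n)"

text \<open>The maximum is taken over a finite nonempty set, so it is a genuine maximum.\<close>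

lemma bit_graph_cas_length_le:
  assumes "pre_digraph.cas bit_graph n p v" "set p \<subseteq> arcs bit_graph"
  shows "length p + v \<le> n"
  using assms
proof (induction p arbitrary: n)
  case Nil
  then show ?case by (simp add: pre_digraph.cas.simps)
next
  case (Cons e p)
  from Cons.prems(2) obtain m s where e: "e = (m, m - 2 ^ s)" "2 ^ s \<le> m"
    by (auto simp: bit_graph_def)
  from Cons.prems(1) e have mn: "m = n" "pre_digraph.cas bit_graph (m - 2 ^ s) p v"
    by (auto simp: pre_digraph.cas.simps bit_graph_def)
  have "length p + v \<le> m - 2 ^ s"
    using Cons.IH[OF mn(2)] Cons.prems(2) by simp
  moreover have "m - 2 ^ s < m"
    using e(2) by (metis diff_less less_le_trans pos2 zero_less_power)
  ultimately show ?case using mn(1) by simp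
qed

lemma path_lengths_le: "l \<in> path_lengths n \<Longrightarrow> l \<le> n"
  by (auto simp: path_lengths_def pre_digraph.apath_def pre_digraph.awalk_def
      dest!: bit_graph_cas_length_le)

lemma finite_path_lengths: "finite (path_lengths n)"
  using path_lengths_le by (meson finite_nat_set_iff_bounded_le)

lemma zero_in_path_lengths: "0 \<in> path_lengths n"
  by (auto simp: path_lengths_def pre_digraph.apath_def pre_digraph.awalk_def
      pre_digraph.cas.simps pre_digraph.awalk_verts.simps bit_graph_def intro!: exI[of _ "[]"])


section \<open>Binary classes\<close>

function strip_ones :: "nat \<Rightarrow> nat" where
  "strip_ones n = (if odd n then strip_ones (n div 2) else n)"
  by auto
termination
  by (relation "measure id") (simp_all add: odd_pos)

declare strip_ones.simps [simp del]

definition binary_class :: "nat \<Rightarrow> nat set" where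
  "binary_class n = {m. strip_ones m = strip_ones n}"

definition class_min :: "nat set \<Rightarrow> nat" where
  "class_min C = (LEAST m. m \<in> C)"

lemma strip_ones_le: "strip_ones n \<le> n"
proof (induction n rule: strip_ones.induct)
  case (1 n)
  show ?case
  proof (cases "odd n")
    case True
    then have "strip_ones n \<le> n div 2" using 1 by (simp add: strip_ones.simps[of n])
    then show ?thesis using div_le_dividend[of n 2] by linarith
  next
    case False
    then show ?thesis by (simp add: strip_ones.simps[of n])
  qed
qed

lemma strip_ones_idem: "strip_ones (strip_ones n) = strip_ones n"
proof (induction n rule: strip_ones.induct)
  case (1 n)
  then show ?case by (cases "odd n") (simp_all add: strip_ones.simps[of n])
qed

lemma class_min_binary_class: "class_min (binary_class n) = strip_ones n"
  unfolding class_min_def binary_class_def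
proof (rule Least_equality)
  show "strip_ones n \<in> {m. strip_ones m = strip_ones n}" by (simp add: strip_ones_idem)
next
  fix m assume "m \<in> {m. strip_ones m = strip_ones n}"
  then show "strip_ones n \<le> m" using strip_ones_le[of m] by simp
qed


section \<open>Bracket form, dimension and \<open>S\<close>\<close>

text \<open>The list \<open>[\<alpha>\<^sub>k, \<dots>, \<alpha>\<^sub>1]\<close> is written in the order of the bracket notation, most
  significant block first. Since \<^const>\<open>horner_sum\<close> reads the least significant digit first,
  the digit string is reversed.\<close>

definition bracket_string :: "nat list \<Rightarrow> bool list" where
  "bracket_string as = concat (map (\<lambda>a. replicate a True @ [False]) as)"

definition bracket :: "nat list \<Rightarrow> nat" where
  "bracket as = horner_sum of_bool 2 (rev (bracket_string as))"

definition is_bracket_form :: "nat \<Rightarrow> nat list \<Rightarrow> bool" where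
  "is_bracket_form m as \<longleftrightarrow> as \<noteq> [] \<and> hd as \<ge> 1 \<and> m = bracket as"

definition class_dim :: "nat \<Rightarrow> nat set \<Rightarrow> bool" where
  "class_dim k C \<longleftrightarrow> (\<exists>as. length as = k \<and> is_bracket_form (class_min C) as)"

text \<open>The exponent \<open>\<alpha>\<^sub>j\<close> is the \<open>j\<close>-th entry from the right, counting from 1.\<close>

definition S :: "nat \<Rightarrow> nat" where
  "S m = (let as = (THE as. is_bracket_form m as)
          in \<Sum>j = 1..length as. j * as ! (length as - j))"

text \<open>The bracket form of a number is unique, so the description in \<^const>\<open>S\<close> is proper
  for every number that has a bracket form, and the dimension of a class is unique.\<close>

lemma horner_sum_of_bool_neq_0:
  assumes "bs \<noteq> []" "last bs"
  shows "horner_sum of_bool 2 bs \<noteq> (0 :: nat)"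
  using assms by (induction bs) (auto split: if_splits)

lemma horner_sum_of_bool_inj:
  assumes "horner_sum of_bool 2 bs = (horner_sum of_bool 2 cs :: nat)"
    and "bs = [] \<or> last bs" "cs = [] \<or> last cs"
  shows "bs = cs"
  using assms
proof (induction bs arbitrary: cs)
  case Nil
  then show ?case using horner_sum_of_bool_neq_0[of cs] by (cases "cs = []") simp_all
next
  case (Cons b bs)
  have "cs \<noteq> []"
    using horner_sum_of_bool_neq_0[of "b # bs"] Cons.prems(1,2) by fastforce
  then obtain c cs' where cs: "cs = c # cs'"
    by (cases cs) auto
  have eq: "of_bool b + 2 * horner_sum of_bool 2 bs
      = (of_bool c + 2 * horner_sum of_bool 2 cs' :: nat)"
    using Cons.prems(1) cs by simp
  have "b = c" using arg_cong[OF eq, of even] by (cases b; cases c) simp_all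
  moreover have "horner_sum of_bool 2 bs = (horner_sum of_bool 2 cs' :: nat)"
    using eq \<open>b = c\<close> by simp
  moreover have "bs = [] \<or> last bs" "cs' = [] \<or> last cs'"
    using Cons.prems(2,3) cs by (simp_all split: if_splits)
  ultimately show ?case using Cons.IH cs by blast
qed

lemma replicate_True_False_inj:
  "replicate a True @ False # xs = replicate b True @ False # ys \<Longrightarrow> a = b \<and> xs = ys"
proof (induction a arbitrary: b)
  case 0
  then show ?case by (cases b) auto
next
  case (Suc a)
  then show ?case by (cases b) auto
qed

lemma bracket_string_inj: "bracket_string as = bracket_string bs \<Longrightarrow> as = bs"
proof (induction as arbitrary: bs)
  case Nil
  then show ?case by (cases bs) (auto simp: bracket_string_def)
next
  case (Cons a as)
  then obtain b bs' where bs: "bs = b # bs'"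
    by (cases bs) (auto simp: bracket_string_def)
  with Cons.prems have "a = b \<and> bracket_string as = bracket_string bs'"
    by (intro replicate_True_False_inj) (simp add: bracket_string_def)
  with Cons.IH bs show ?case by blast
qed

lemma is_bracket_form_unique:
  assumes "is_bracket_form m as" "is_bracket_form m bs"
  shows "as = bs"
proof -
  have last: "last (rev (bracket_string cs))" if "is_bracket_form m cs" for cs
  proof -
    from that obtain c cs' where "cs = Suc c # cs'"
      by (cases cs; cases "hd cs") (auto simp: is_bracket_form_def)
    then show ?thesis by (simp add: bracket_string_def)
  qed
  have "rev (bracket_string as) = rev (bracket_string bs)"
    using assms last by (intro horner_sum_of_bool_inj) (auto simp: is_bracket_form_def bracket_def)
  then show ?thesis using bracket_string_inj by simp
qed

lemma S_eq:
  assumes "is_bracket_form m as"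
  shows "S m = (\<Sum>j = 1..length as. j * as ! (length as - j))"
proof -
  have "(THE as. is_bracket_form m as) = as"
    using assms is_bracket_form_unique by blast
  then show ?thesis by (simp add: S_def)
qed

definition Delta :: "nat \<Rightarrow> nat" where
  "Delta k = [0, 0, 0, 1, 2, 4, 7] ! (k - 1)"

end

theory Submission
  imports Defs
begin

text \<open>Subtracting \<open>2 ^ s\<close> replaces a substring \<open>10\<^sup>m\<close> (with \<open>m \<ge> 1\<close>) by \<open>01\<^sup>m\<close>. Let \<open>k\<close> be the number
  of zero digits and let \<open>S\<close> count the pairs of a one and a zero to its right. If the replaced one is
  the leading digit, \<open>k\<close> drops by \<open>m\<close> and \<open>S\<close> grows by \<open>(m - 1) (k - m) - m\<close>; otherwise \<open>k\<close> drops by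
  \<open>m - 1\<close> and \<open>S\<close> grows by at most \<open>(m - 1) (k - m) - 2 m + 1\<close>. For \<open>k \<le> 7\<close> a check of the finitely many
  pairs \<open>(k, m)\<close> shows that \<open>S + \<Delta>\<^sub>k\<close> drops by at least 1 along each edge. It drops by exactly 1 for
  every move with \<open>m = 1\<close> that keeps the leading digit, and if no such move exists the
  number is \<open>10\<^sup>k1\<^sup>t\<close>, where \<open>m = 1, 1, 1, 2, 2, 2, 3\<close> works for \<open>k = 1, \<dots>, 7\<close>.\<close>

section \<open>Digit statistics\<close>

fun ones :: "nat \<Rightarrow> nat" where
  "ones n = (if n = 0 then 0 else of_bool (odd n) + ones (n div 2))"

text \<open>The number 0 has the empty digit string here, so only zeros below the leading one
  count.\<close>

fun zeros :: "nat \<Rightarrow> nat" where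
  "zeros n = (if n = 0 then 0 else of_bool (even n) + zeros (n div 2))"

fun inversions :: "nat \<Rightarrow> nat" where
  "inversions n =
     (if n = 0 then 0 else (if even n then ones (n div 2) else 0) + inversions (n div 2))"

declare ones.simps [simp del] zeros.simps [simp del] inversions.simps [simp del]

lemma digit_stats_0 [simp]: "ones 0 = 0" "zeros 0 = 0" "inversions 0 = 0"
  by (simp_all add: ones.simps zeros.simps inversions.simps)

lemma digit_stats_double [simp]:
  "ones (2 * n) = ones n"
  "n > 0 \<Longrightarrow> zeros (2 * n) = Suc (zeros n)"
  "inversions (2 * n) = ones n + inversions n"
  by (simp_all add: ones.simps[of "2 * n"] zeros.simps[of "2 * n"] inversions.simps[of "2 * n"])

lemma digit_stats_Suc_double [simp]:
  "ones (Suc (2 * n)) = Suc (ones n)"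
  "zeros (Suc (2 * n)) = zeros n"
  "inversions (Suc (2 * n)) = inversions n"
  by (simp_all add: ones.simps[of "Suc (2 * n)"] zeros.simps[of "Suc (2 * n)"]
      inversions.simps[of "Suc (2 * n)"])

lemma ones_pos: "n > 0 \<Longrightarrow> ones n > 0"
proof (induction n rule: less_induct)
  case (less n)
  then show ?case
    by (cases "odd n") (auto elim!: evenE oddE)
qed

lemma digit_stats_append_zeros:
  assumes "n > 0"
  shows "ones (2 ^ m * n) = ones n"
    and "zeros (2 ^ m * n) = zeros n + m"
    and "inversions (2 ^ m * n) = inversions n + m * ones n"
  by (induction m) (use assms in \<open>simp_all add: mult.assoc\<close>)

text \<open>The number \<open>2 ^ t * Suc n - 1\<close> equals
  \<open>2 ^ t * n + (2 ^ t - 1)\<close>: the digits of \<open>n\<close> followed by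
  \<open>t\<close> ones.\<close>

lemma digit_stats_append_ones:
  shows "ones (2 ^ t * Suc n - 1) = ones n + t"
    and "zeros (2 ^ t * Suc n - 1) = zeros n"
    and "inversions (2 ^ t * Suc n - 1) = inversions n"
proof (induction t)
  case (Suc t)
  have "2 ^ t * Suc n > 0"
    by simp
  then have eq: "2 ^ Suc t * Suc n - 1 = Suc (2 * (2 ^ t * Suc n - 1))"
    unfolding power_Suc mult.assoc by arith
  {
    case 1 show ?case unfolding eq digit_stats_Suc_double Suc by simp
  next
    case 2 show ?case unfolding eq digit_stats_Suc_double Suc by simp
  next
    case 3 show ?case unfolding eq digit_stats_Suc_double Suc by simp
  }
qed simp_all

lemma odd_part_exists: "n > 0 \<Longrightarrow> \<exists>m c. n = 2 ^ m * Suc (2 * c)" for n :: nat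
proof (induction n rule: less_induct)
  case (less n)
  show ?case
  proof (cases "even n")
    case True
    then obtain a where a: "n = 2 * a" by blast
    with less obtain m c where "a = 2 ^ m * Suc (2 * c)" by fastforce
    then have "n = 2 ^ Suc m * Suc (2 * c)" using a by simp
    then show ?thesis by blast
  next
    case False
    then obtain c where "n = Suc (2 * c)" by (auto elim: oddE)
    then have "n = 2 ^ 0 * Suc (2 * c)" by simp
    then show ?thesis by blast
  qed
qed

section \<open>Edges\<close>

definition edge :: "nat \<Rightarrow> nat \<Rightarrow> bool" where
  "edge n n' \<longleftrightarrow> (\<exists>s. \<not> bit n s \<and> 2 ^ s \<le> n \<and> n' = n - 2 ^ s)"

lemma edge_lowest: "n > 0 \<Longrightarrow> edge (2 * n) (2 * n - 1)"
  unfolding edge_def by (rule exI[of _ 0]) (simp add: bit_0)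

lemma edge_append_digit:
  assumes "edge n n'" "b \<le> 1"
  shows "edge (2 * n + b) (2 * n' + b)"
proof -
  from assms(1) obtain s where s: "\<not> bit n s" "2 ^ s \<le> n" "n' = n - 2 ^ s"
    unfolding edge_def by blast
  have "(2 * n + b) div 2 = n" using assms(2) by simp
  then have "\<not> bit (2 * n + b) (Suc s)" using s by (simp add: bit_Suc)
  moreover have "2 ^ Suc s \<le> 2 * n + b" "2 * n' + b = 2 * n + b - 2 ^ Suc s"
    using s by auto
  ultimately show ?thesis unfolding edge_def by blast
qed

lemma edge_append_ones:
  "edge n n' \<Longrightarrow> edge (2 ^ t * Suc n - 1) (2 ^ t * Suc n' - 1)"
proof (induction t)
  case (Suc t)
  have "2 ^ Suc t * Suc m - 1 = 2 * (2 ^ t * Suc m - 1) + 1" for m :: nat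
  proof -
    have "2 ^ t * Suc m > 0" by simp
    then show ?thesis unfolding power_Suc mult.assoc by arith
  qed
  then show ?case using edge_append_digit[OF Suc.IH[OF Suc.prems], of 1] by simp
qed simp

text \<open>The lowest \<open>s\<close> digits agree at both ends of an edge. Stripping them one by
  one leaves the subtraction of 1 from a positive even number.\<close>

lemma edge_induct [consumes 1, case_names lowest append]:
  assumes "edge n n'"
    and lowest: "\<And>n. n > 0 \<Longrightarrow> P (2 * n) (2 * n - 1)"
    and append: "\<And>n n' b. edge n n' \<Longrightarrow> P n n' \<Longrightarrow> b \<le> 1 \<Longrightarrow> P (2 * n + b) (2 * n' + b)"
  shows "P n n'"
proof -
  have "P n (n - 2 ^ s)" if "\<not> bit n s" "2 ^ s \<le> n" for s
    using that
  proof (induction s arbitrary: n)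
    case 0
    then obtain a where a: "n = 2 * a" by (auto simp: bit_0)
    with 0(2) have "a > 0" by simp
    from lowest[OF this] show ?case by (simp add: a)
  next
    case (Suc s)
    define a b where "a = n div 2" and "b = n mod 2"
    have n: "n = 2 * a + b" "b \<le> 1" by (auto simp: a_def b_def)
    have *: "\<not> bit a s" "2 ^ s \<le> a"
      using Suc.prems unfolding a_def bit_Suc power_Suc by simp_all
    then have "edge a (a - 2 ^ s)" unfolding edge_def by blast
    from append[OF this Suc.IH[OF *] n(2)] show ?case
      using n * by (simp add: algebra_simps)
  qed
  then show ?thesis using assms(1) unfolding edge_def by blast
qed

text \<open>The target 0 would need \<open>n = 2 ^ s\<close>, whose bit \<open>s\<close> is
  set.\<close>

lemma edge_pos: "edge n n' \<Longrightarrow> 0 < n'"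
  by (induction rule: edge_induct) auto

lemma edge_less: "edge n n' \<Longrightarrow> n' < n"
  unfolding edge_def by (metis diff_less less_le_trans pos2 zero_less_power)

text \<open>Here \<open>m\<close> is the length of the zero run in the replaced string. If
  \<open>r\<close> zeros lie below it, the ones created add \<open>(m - 1) * r\<close> inversions,
  and the \<open>m\<close> inversions inside the string are lost. For a leading one (first disjunct)
  \<open>r = zeros n - m\<close>. Otherwise \<open>r\<close> is at most that, and each one above the
  string loses a further \<open>m - 1\<close> inversions.\<close>

lemma edge_digit_stats:
  assumes "edge n n'"
  shows "\<exists>m. 1 \<le> m \<and> m \<le> zeros n \<and> ones n' = ones n + m - 1 \<and>
    (zeros n' = zeros n - m \<and>
       inversions n' + m = inversions n + (m - 1) * (zeros n - m) \<or>
     zeros n' = zeros n + 1 - m \<and>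
       inversions n' + 2 * m - 1 \<le> inversions n + (m - 1) * (zeros n - m))"
  using assms
proof (induction rule: edge_induct)
  case (lowest n)
  then obtain m c where n: "n = 2 ^ m * Suc (2 * c)"
    using odd_part_exists by blast
  \<comment> \<open>Below the digits of \<open>c\<close>, the string is a one and \<open>M\<close>
    zeros in \<open>2 * n\<close>, and a zero and \<open>M\<close> ones in \<open>2 * n - 1\<close>.
    The one is leading exactly if \<open>c = 0\<close>.\<close>
  define M where "M = Suc m"
  have eq: "2 * n = 2 ^ M * Suc (2 * c)" "2 * n - 1 = 2 ^ M * Suc (2 * c) - 1"
    using n by (simp_all add: M_def)
  show ?case
  proof (intro exI[of _ M], cases "c = 0")
    case True
    then show "1 \<le> M \<and> M \<le> zeros (2 * n) \<and> ones (2 * n - 1) = ones (2 * n) + M - 1 \<and>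
      (zeros (2 * n - 1) = zeros (2 * n) - M \<and>
       inversions (2 * n - 1) + M = inversions (2 * n) + (M - 1) * (zeros (2 * n) - M) \<or>
       zeros (2 * n - 1) = zeros (2 * n) + 1 - M \<and>
       inversions (2 * n - 1) + 2 * M - 1 \<le> inversions (2 * n) + (M - 1) * (zeros (2 * n) - M))"
      unfolding eq digit_stats_append_ones
      by (simp add: digit_stats_append_zeros digit_stats_Suc_double[of 0, simplified] M_def
          del: mult_Suc_right power_Suc)
  next
    case False
    \<comment> \<open>At least one digit one of \<open>c\<close> lies above the zero run, which
      shrinks from \<open>M\<close> to a single zero.\<close>
    have le: "m \<le> m * ones c + x" for x
      using ones_pos[of c] False by (simp add: trans_le_add1)
    then show "1 \<le> M \<and> M \<le> zeros (2 * n) \<and> ones (2 * n - 1) = ones (2 * n) + M - 1 \<and>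
      (zeros (2 * n - 1) = zeros (2 * n) - M \<and>
       inversions (2 * n - 1) + M = inversions (2 * n) + (M - 1) * (zeros (2 * n) - M) \<or>
       zeros (2 * n - 1) = zeros (2 * n) + 1 - M \<and>
       inversions (2 * n - 1) + 2 * M - 1 \<le> inversions (2 * n) + (M - 1) * (zeros (2 * n) - M))"
      unfolding eq digit_stats_append_ones
      using False by (simp add: digit_stats_append_zeros M_def del: mult_Suc_right power_Suc)
        (simp add: algebra_simps le)
  qed
next
  case (append n n' b)
  have pos: "n > 0" "n' > 0"
    using edge_pos edge_less append.hyps(1) by fastforce+
  from append.IH obtain m where m: "1 \<le> m" "m \<le> zeros n" "ones n' = ones n + m - 1"
    and or: "zeros n' = zeros n - m \<and>
       inversions n' + m = inversions n + (m - 1) * (zeros n - m) \<or>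
     zeros n' = zeros n + 1 - m \<and>
       inversions n' + 2 * m - 1 \<le> inversions n + (m - 1) * (zeros n - m)"
    by blast
  \<comment> \<open>Naming the product keeps the goals linear. Appending a zero adds
    \<open>ones n'\<close> and \<open>ones n\<close> inversions at the two ends; their difference
    \<open>m - 1\<close> is also the growth of the product.\<close>
  obtain p where p: "p = (m - 1) * (zeros n - m)"
    by blast
  then have Suc_diff: "(m - 1) * (Suc (zeros n) - m) = p + (m - 1)"
    using m(2) by (simp add: Suc_diff_le)
  from append.hyps(2) consider "b = 0" | "b = 1" by linarith
  then show ?case
  proof cases
    case 1
    show ?thesis
      unfolding 1 add_0_right digit_stats_double(1,3) digit_stats_double(2)[OF pos(1)]
        digit_stats_double(2)[OF pos(2)]
    proof (rule exI[of _ m], unfold Suc_diff, use or[folded p] in \<open>elim disjE conjE\<close>)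
      assume "zeros n' = zeros n - m" "inversions n' + m = inversions n + p"
      with m show "1 \<le> m \<and> m \<le> Suc (zeros n) \<and> ones n' = ones n + m - 1 \<and>
          (Suc (zeros n') = Suc (zeros n) - m \<and>
             ones n' + inversions n' + m = ones n + inversions n + (p + (m - 1)) \<or>
           Suc (zeros n') = Suc (zeros n) + 1 - m \<and>
             ones n' + inversions n' + 2 * m - 1 \<le> ones n + inversions n + (p + (m - 1)))"
        by (intro conjI disjI1) linarith+
    next
      assume "zeros n' = zeros n + 1 - m" "inversions n' + 2 * m - 1 \<le> inversions n + p"
      with m show "1 \<le> m \<and> m \<le> Suc (zeros n) \<and> ones n' = ones n + m - 1 \<and>
          (Suc (zeros n') = Suc (zeros n) - m \<and>
             ones n' + inversions n' + m = ones n + inversions n + (p + (m - 1)) \<or>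
           Suc (zeros n') = Suc (zeros n) + 1 - m \<and>
             ones n' + inversions n' + 2 * m - 1 \<le> ones n + inversions n + (p + (m - 1)))"
        by (intro conjI disjI2) linarith+
    qed
  next
    case 2
    have eq: "2 * x + 1 = Suc (2 * x)" for x :: nat by simp
    show ?thesis
      unfolding 2 eq digit_stats_Suc_double
      by (rule exI[of _ m]) (use m or in auto)
  qed
qed

text \<open>A unit edge turns 10 into 01 below the leading digit. If no one other than the leading
  digit is directly followed by a zero, all zeros form a single run right after the leading
  one.\<close>

lemma exists_unit_edge:
  assumes "zeros n > 0"
  shows "(\<exists>n'. edge n n' \<and> ones n' = ones n \<and> zeros n' = zeros n \<and>
      Suc (inversions n') = inversions n) \<or>
    (\<exists>k t. n = 2 ^ t * Suc (2 ^ k) - 1)"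
  using assms
proof (induction n rule: less_induct)
  case (less n)
  then have "n > 0" by (metis digit_stats_0(2) neq0_conv)
  show ?case
  proof (cases "odd n")
    case True
    then obtain a where a: "n = Suc (2 * a)" by (auto elim: oddE)
    with less.prems have "zeros a > 0" by simp
    with less.IH[of a] a consider
      (unit) a' where "edge a a'" "ones a' = ones a" "zeros a' = zeros a"
        "Suc (inversions a') = inversions a"
      | (power) k t where "a = 2 ^ t * Suc (2 ^ k) - 1" by auto
    then show ?thesis
    proof cases
      case unit
      then show ?thesis
        using edge_append_digit[of a a' 1] a by (intro disjI1 exI[of _ "Suc (2 * a')"]) simp
    next
      case power
      have "2 ^ t * Suc (2 ^ k) > (0 :: nat)" by simp
      then have "n = 2 ^ Suc t * Suc (2 ^ k) - 1"
        unfolding a power power_Suc mult.assoc by arith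
      then show ?thesis by blast
    qed
  next
    case False
    then obtain a where a: "n = 2 * a" by blast
    with \<open>n > 0\<close> have "a > 0" by simp
    show ?thesis
    proof (cases "odd a")
      case True
      then obtain c where c: "a = Suc (2 * c)" by (auto elim: oddE)
      \<comment> \<open>The digits of \<open>n\<close> end in 10, and this one is leading exactly if
        \<open>c = 0\<close>.\<close>
      show ?thesis
      proof (cases "c = 0")
        case True
        then have "n = 2 ^ 0 * Suc (2 ^ 0) - 1 \<or> n = 2 ^ 0 * Suc (2 ^ 1) - 1"
          using a c by simp
        then show ?thesis by blast
      next
        case False
        have "edge n (Suc (2 * (2 * c)))"
          using edge_lowest[of a] a c by simp
        moreover have "ones (Suc (2 * (2 * c))) = ones n" "zeros (Suc (2 * (2 * c))) = zeros n"
          "Suc (inversions (Suc (2 * (2 * c)))) = inversions n"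
          unfolding a c digit_stats_Suc_double using False
          by (simp_all only: digit_stats_double digit_stats_Suc_double)
        ultimately show ?thesis by blast
      qed
    next
      case False
      then obtain c where c: "a = 2 * c" by blast
      with \<open>a > 0\<close> have "zeros a > 0" by simp
      with less.IH[of a] a \<open>a > 0\<close> consider
        (unit) a' where "edge a a'" "ones a' = ones a" "zeros a' = zeros a"
          "Suc (inversions a') = inversions a"
        | (power) k t where "a = 2 ^ t * Suc (2 ^ k) - 1" by auto
      then show ?thesis
      proof cases
        case unit
        then show ?thesis
          using edge_append_digit[of a a' 0] edge_pos[of a a'] a \<open>a > 0\<close>
          by (intro disjI1 exI[of _ "2 * a'"]) simp
      next
        case power
        \<comment> \<open>Trailing ones are impossible because \<open>a\<close> is even.\<close>
        have "t = 0"
        proof (rule ccontr)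
          assume "t \<noteq> 0"
          then have "even (2 ^ t * Suc (2 ^ k) :: nat)" "2 ^ t * Suc (2 ^ k) > (0 :: nat)" by simp_all
          then have "odd a" unfolding power by simp
          then show False using \<open>\<not> odd a\<close> by simp
        qed
        then have "n = 2 ^ 0 * Suc (2 ^ Suc k) - 1" using a power by simp
        then show ?thesis by blast
      qed
    qed
  qed
qed

section \<open>The potential\<close>

text \<open>Truncated subtraction in the list index makes \<open>Delta 0 = 0\<close>, so numbers
  without zero digits are covered as well.\<close>

definition potential :: "nat \<Rightarrow> nat" where
  "potential n = inversions n + Delta (zeros n)"

lemma potential_edge_less:
  assumes "zeros n \<le> 7" "edge n n'"
  shows "zeros n' \<le> 7 \<and> potential n' < potential n"
proof -
  define k where "k = zeros n"
  from edge_digit_stats[OF assms(2)] obtain m where m: "1 \<le> m" "m \<le> k"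
    and or: "zeros n' = k - m \<and> inversions n' + m = inversions n + (m - 1) * (k - m) \<or>
     zeros n' = k + 1 - m \<and> inversions n' + 2 * m - 1 \<le> inversions n + (m - 1) * (k - m)"
    unfolding k_def by blast
  have "k \<le> 7" using assms(1) k_def by simp
  have "k \<in> {1, 2, 3, 4, 5, 6, 7}" "m \<in> {1, 2, 3, 4, 5, 6, 7}"
    using m \<open>k \<le> 7\<close> by auto
  \<comment> \<open>The inequalities for a leading and for a nonleading one, evaluated for all pairs
    with \<open>m \<le> k\<close>.\<close>
  then have "Delta (k - m) + (m - 1) * (k - m) < Delta k + m"
    "Delta (k + 1 - m) + (m - 1) * (k - m) < Delta k + 2 * m - 1"
    using m(2) by (auto simp: Delta_def)
  then show ?thesis
    using or m \<open>k \<le> 7\<close> unfolding potential_def k_def[symmetric]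
    by (elim disjE conjE; intro conjI) (simp_all only:, linarith+)
qed

lemma potential_edge_Suc:
  assumes "zeros n \<le> 7" "zeros n > 0"
  shows "\<exists>n'. edge n n' \<and> potential n = Suc (potential n')"
  using exists_unit_edge[OF assms(2)]
proof (elim disjE exE conjE)
  fix n' assume "edge n n'" "zeros n' = zeros n" "Suc (inversions n') = inversions n"
  then show ?thesis by (intro exI[of _ n']) (simp add: potential_def)
next
  fix k t assume n: "n = 2 ^ t * Suc (2 ^ k) - 1"
  have stats: "ones 1 = 1" "zeros 1 = 0" "inversions 1 = 0"
    using digit_stats_Suc_double[of 0] by simp_all
  have k: "zeros n = k"
    unfolding n digit_stats_append_ones using digit_stats_append_zeros(2)[of 1 k] stats by simp
  \<comment> \<open>These run lengths make the leading move lower the potential by exactly 1. The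
    entry at index 0 is a filler.\<close>
  define m :: nat where "m = [0, 1, 1, 1, 2, 2, 2, 3] ! k"
  have "k \<in> {1, 2, 3, 4, 5, 6, 7}"
    using assms k by auto
  then have m: "1 \<le> m" "m \<le> k" "m * (k - m) + Delta (k - m) + 1 = k + Delta k"
    by (auto simp: m_def Delta_def)
  \<comment> \<open>In binary, \<open>x\<close> is \<open>m\<close> ones followed by
    \<open>k - m\<close> zeros: the result of subtracting \<open>2 ^ (k - m)\<close> from
    \<open>2 ^ k\<close>.\<close>
  define x where "x = 2 ^ (k - m) * (2 ^ m - 1 :: nat)"
  have pos: "2 ^ m - 1 > (0 :: nat)"
    using m(1) less_exp[of m] by linarith
  have "2 ^ k = (2 ^ (k - m) * 2 ^ m :: nat)"
    using m(2) by (simp flip: power_add)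
  then have x: "x = 2 ^ k - 2 ^ (k - m)"
    by (simp add: x_def right_diff_distrib')
  have "k - m \<noteq> k" using m by simp
  then have "edge (2 ^ k) x"
    unfolding edge_def x by (intro exI[of _ "k - m"]) (simp add: bit_exp_iff)
  then have "edge n (2 ^ t * Suc x - 1)"
    unfolding n by (rule edge_append_ones)
  moreover have "potential n = k + Delta k"
    unfolding n potential_def digit_stats_append_ones
    using digit_stats_append_zeros[of 1 k] stats by simp
  moreover have "potential (2 ^ t * Suc x - 1) = m * (k - m) + Delta (k - m)"
    unfolding potential_def digit_stats_append_ones x_def digit_stats_append_zeros[OF pos]
    using digit_stats_append_ones[of m 0] by (simp add: mult.commute)
  ultimately show ?thesis using m(3) by auto
qed

section \<open>Paths\<close>

lemma arcs_bit_graph_iff: "e \<in> arcs bit_graph \<longleftrightarrow> edge (fst e) (snd e)"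
  by (auto simp: bit_graph_def edge_def prod_eq_iff)

lemma apath_Nil: "pre_digraph.apath bit_graph n [] n"
  by (simp add: pre_digraph.apath_def pre_digraph.awalk_def pre_digraph.cas.simps
      pre_digraph.awalk_verts.simps bit_graph_def)

lemma awalk_verts_le:
  assumes "pre_digraph.cas bit_graph n p v" "set p \<subseteq> arcs bit_graph"
    and "u \<in> set (pre_digraph.awalk_verts bit_graph n p)"
  shows "u \<le> n"
  using assms
proof (induction p arbitrary: n)
  case Nil
  then show ?case by (simp add: pre_digraph.awalk_verts.simps)
next
  case (Cons e p)
  have "n = fst e" "pre_digraph.cas bit_graph (snd e) p v"
    using Cons.prems(1) by (simp_all add: pre_digraph.cas.simps bit_graph_def)
  moreover have "snd e < fst e"
    using Cons.prems(2) edge_less by (simp add: arcs_bit_graph_iff)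
  ultimately show ?case
    using Cons.IH[of "snd e"] Cons.prems(2,3)
    by (fastforce simp: pre_digraph.awalk_verts.simps bit_graph_def)
qed

text \<open>Edges strictly decrease, so \<open>n\<close> exceeds every vertex of a walk starting at
  \<open>snd e\<close>, and distinctness of the vertices is automatic.\<close>

lemma apath_Cons:
  "pre_digraph.apath bit_graph n (e # p) v \<longleftrightarrow>
     fst e = n \<and> edge n (snd e) \<and> pre_digraph.apath bit_graph (snd e) p v"
proof -
  have "n \<notin> set (pre_digraph.awalk_verts bit_graph n' p)"
    if "edge n n'" "pre_digraph.cas bit_graph n' p v" "set p \<subseteq> arcs bit_graph" for n'
    using awalk_verts_le[OF that(2,3), of n] edge_less[OF that(1)] by auto
  then show ?thesis
    by (auto simp: pre_digraph.apath_def pre_digraph.awalk_def pre_digraph.cas.simps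
        pre_digraph.awalk_verts.simps arcs_bit_graph_iff)
       (auto simp: bit_graph_def)
qed

lemma apath_length_le_potential:
  "zeros n \<le> 7 \<Longrightarrow> pre_digraph.apath bit_graph n p v \<Longrightarrow> length p \<le> potential n"
proof (induction p arbitrary: n)
  case (Cons e p)
  then have e: "edge n (snd e)" and p: "pre_digraph.apath bit_graph (snd e) p v"
    by (simp_all add: apath_Cons)
  have "zeros (snd e) \<le> 7" "potential (snd e) < potential n"
    using potential_edge_less[OF Cons.prems(1) e] by auto
  then show ?case using Cons.IH[OF _ p] by fastforce
qed simp

lemma zeros_eq_0_imp_inversions: "zeros n = 0 \<Longrightarrow> inversions n = 0"
proof (induction n rule: less_induct)
  case (less n)
  show ?case
  proof (cases "n = 0")
    case False
    with less show ?thesis by (cases "even n") (auto elim!: evenE oddE)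
  qed simp
qed

text \<open>Edges that lower the potential by exactly 1 can be followed until no zero digit is left,
  where the potential is 0.\<close>

lemma apath_of_length_potential:
  "zeros n \<le> 7 \<Longrightarrow> \<exists>p v. pre_digraph.apath bit_graph n p v \<and> length p = potential n"
proof (induction n rule: less_induct)
  case (less n)
  show ?case
  proof (cases "zeros n = 0")
    case True
    then have "potential n = 0" by (simp add: potential_def zeros_eq_0_imp_inversions Delta_def)
    then show ?thesis using apath_Nil by fastforce
  next
    case False
    with potential_edge_Suc less.prems
    obtain n' where n': "edge n n'" "potential n = Suc (potential n')"
      by blast
    obtain p v where "pre_digraph.apath bit_graph n' p v" "length p = potential n'"
      using less.IH[OF edge_less] potential_edge_less less.prems n'(1) by blast
    then have "pre_digraph.apath bit_graph n ((n, n') # p) v" "length ((n, n') # p) = potential n"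
      using n' by (simp_all add: apath_Cons)
    then show ?thesis by blast
  qed
qed

lemma longest_path_eq_potential:
  assumes "zeros n \<le> 7"
  shows "longest_path n = potential n"
  unfolding longest_path_def
proof (rule Max_eqI[OF finite_path_lengths])
  show "potential n \<in> path_lengths n"
    using apath_of_length_potential[OF assms] unfolding path_lengths_def
    by (metis (mono_tags, lifting) mem_Collect_eq)
next
  fix l assume "l \<in> path_lengths n"
  then show "l \<le> potential n"
    using apath_length_le_potential[OF assms] by (auto simp: path_lengths_def)
qed

section \<open>Bracket forms\<close>

text \<open>A trailing one has no zero below it, so both statistics depend only on the binary
  class.\<close>

lemma strip_ones_digit_stats:
  "zeros (strip_ones n) = zeros n" "inversions (strip_ones n) = inversions n"
proof (induction n rule: less_induct)
  case (less n)
  have *: "P (strip_ones n) = P n"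
    if "\<And>m. m < n \<Longrightarrow> P (strip_ones m) = P m" "\<And>m. P (Suc (2 * m)) = P m"
    for P :: "nat \<Rightarrow> nat"
    using that by (cases "odd n") (auto elim!: oddE simp: strip_ones.simps[of n])
  {
    case 1 show ?case using less by (intro *) simp_all
  next
    case 2 show ?case using less by (intro *) simp_all
  }
qed

lemma bracket_snoc: "bracket (as @ [a]) = 2 * (2 ^ a * Suc (bracket as) - 1)"
proof -
  have "horner_sum of_bool 2 (replicate a True @ bs) =
      2 ^ a * Suc (horner_sum of_bool 2 bs) - (1 :: nat)" for bs
  proof (induction a)
    case (Suc a)
    have "2 ^ a * Suc (horner_sum of_bool 2 bs) > (0 :: nat)" by simp
    then show ?case
      unfolding replicate_Suc append_Cons horner_sum_simps Suc power_Suc mult.assoc of_bool_eq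
      by arith
  qed simp
  then show ?thesis
    by (simp add: bracket_def bracket_string_def)
qed

text \<open>The new entry gets weight 1 and every older weight rises by 1. Likewise the new final
  zero pairs with every one, old or new.\<close>

lemma weighted_sum_snoc:
  fixes as :: "nat list"
  shows "(\<Sum>j = 1..length (as @ [a]). j * (as @ [a]) ! (length (as @ [a]) - j)) =
    (\<Sum>j = 1..length as. j * as ! (length as - j)) + sum_list as + a"
proof -
  let ?n = "length as"
  have "(\<Sum>j = 1..length (as @ [a]). j * (as @ [a]) ! (length (as @ [a]) - j)) =
      a + (\<Sum>j = Suc 1..Suc ?n. j * (as @ [a]) ! (Suc ?n - j))"
    by (subst sum.atLeast_Suc_atMost) (simp_all add: nth_append)
  also have "(\<Sum>j = Suc 1..Suc ?n. j * (as @ [a]) ! (Suc ?n - j)) =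
      (\<Sum>j = 1..?n. Suc j * as ! (?n - j))"
    unfolding sum.shift_bounds_cl_Suc_ivl by (intro sum.cong) (auto simp: nth_append)
  also have "\<dots> = (\<Sum>j = 1..?n. as ! (?n - j)) + (\<Sum>j = 1..?n. j * as ! (?n - j))"
    by (simp add: sum.distrib)
  also have "(\<Sum>j = 1..?n. as ! (?n - j)) = (\<Sum>i < ?n. as ! i)"
    by (rule sum.reindex_bij_witness[of _ "\<lambda>i. ?n - i" "\<lambda>j. ?n - j"]) auto
  also have "\<dots> = sum_list as"
    by (simp add: sum_list_sum_nth atLeast0LessThan)
  finally show ?thesis by simp
qed

text \<open>Each block ends in one zero, and the ones of the \<open>j\<close>-th block from the
  right stand above exactly \<open>j\<close> zeros. The condition on \<open>hd as\<close> keeps the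
  number positive, as the doubling rule for \<open>zeros\<close> requires.\<close>

lemma bracket_digit_stats:
  assumes "as \<noteq> []" "hd as \<ge> 1"
  shows "bracket as > 0"
    and "ones (bracket as) = sum_list as"
    and "zeros (bracket as) = length as"
    and "inversions (bracket as) = (\<Sum>j = 1..length as. j * as ! (length as - j))"
proof -
  have "bracket as > 0 \<and> ones (bracket as) = sum_list as \<and> zeros (bracket as) = length as \<and>
    inversions (bracket as) = (\<Sum>j = 1..length as. j * as ! (length as - j))"
    using assms
  proof (induction as rule: rev_nonempty_induct)
    case (single a)
    then have "a < 2 ^ a" "a \<ge> 1" by simp_all
    then have pos: "2 ^ a * Suc 0 - 1 > (0 :: nat)" by linarith
    have "bracket [a] = 2 * (2 ^ a * Suc 0 - 1)"
      using bracket_snoc[of "[]" a] by (simp add: bracket_def bracket_string_def)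
    with pos show ?case
      by (simp only: digit_stats_double digit_stats_append_ones) simp
  next
    case (snoc a as)
    then have IH: "bracket as > 0" "ones (bracket as) = sum_list as"
      "zeros (bracket as) = length as"
      "inversions (bracket as) = (\<Sum>j = 1..length as. j * as ! (length as - j))"
      by simp_all
    have "1 < 1 * Suc (bracket as)"
      using IH(1) by simp
    also have "\<dots> \<le> 2 ^ a * Suc (bracket as)"
      by (rule mult_right_mono) simp_all
    finally have pos: "2 ^ a * Suc (bracket as) - 1 > 0"
      unfolding zero_less_diff .
    show ?case
      unfolding bracket_snoc weighted_sum_snoc digit_stats_double(1,3) digit_stats_double(2)[OF pos]
        digit_stats_append_ones IH
      using pos by simp
  qed
  then show "bracket as > 0" "ones (bracket as) = sum_list as" "zeros (bracket as) = length as"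
    "inversions (bracket as) = (\<Sum>j = 1..length as. j * as ! (length as - j))"
    by simp_all
qed

theorem theorem1p3:
  fixes k n :: nat
  assumes "k \<in> {1, 2, 3, 4, 5, 6, 7}"
    and "class_dim k (binary_class n)"
  shows "longest_path n = S (class_min (binary_class n)) + Delta k"
proof -
  from assms(2) obtain as where as: "length as = k" "is_bracket_form (strip_ones n) as"
    unfolding class_dim_def class_min_binary_class by blast
  then have br: "as \<noteq> []" "hd as \<ge> 1" "strip_ones n = bracket as"
    by (simp_all add: is_bracket_form_def)
  have zeros: "zeros n = k"
    using bracket_digit_stats(3)[OF br(1,2)] as(1) strip_ones_digit_stats(1)[of n] br(3) by simp
  have "inversions n = S (strip_ones n)"
    using bracket_digit_stats(4)[OF br(1,2)] S_eq[OF as(2)] strip_ones_digit_stats(2)[of n] br(3)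
    by simp
  then show ?thesis
    using longest_path_eq_potential[of n] assms(1) zeros
    by (auto simp: potential_def class_min_binary_class)
qed

end
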